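(* Let $K$ be a finite simplicial complex and let $T\subseteq K$ be its set of toplexes. Let $\vec z=(z(\sigma,\tau))$, with one binary variable $z(\sigma,\tau)\in\{0,1\}$ for each pair $\sigma<\tau$ with $\sigma\in K$ and $\tau\in T$, be any solution (i.e. feasible point) of the optimization problem $$\text{minimize } f(\vec z)=\vec c\cdot\vec z$$ subject to $$\sum_{\tau\in T,\ \sigma<\tau} z(\sigma,\tau)=1\quad\text{for every }\sigma\in K\setminus T,$$ $$z(\sigma_i,\tau)-z(\sigma_j,\tau)\le 0\quad\text{for every triple }\sigma_i<\sigma_j<\tau\text{ with }\sigma_i,\sigma_j\in K,\ \tau\in T,\ \dim\sigma_i+1=\dim\sigma_j,$$ where $\vec c$ is the real cost vector of the problem. For each $\tau\in T$ put $$V_\tau=\{\sigma\in K\mid \sigma<\tau\text{ and } z(\sigma,\tau)=1\}\cup\{\tau\}.$$ Then $\mathcal V=\{V_\tau\mid\tau\in T\}$ is a combinatorial multivector field on $K$.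
   Context: Simplices are nonempty, and $K$ is ordered by the face relation: $\sigma\le\tau$ means $\sigma$ is a face of $\tau$, and $\sigma<\tau$ means $\sigma$ is a proper face of $\tau$. A toplex is a simplex of $K$ that is maximal with respect to $\le$. A subset $A\subseteq K$ is convex if for all $x,z\in A$ and $y\in K$ with $x\le y\le z$ one has $y\in A$ (equivalently, $A$ is locally closed in the finite $T_0$ topology on $K$ whose open sets are the upper sets). A combinatorial multivector field on $K$ is a partition of $K$ into (nonempty) convex subsets, called multivectors. The cost vector $\vec c$ has one real entry per variable; it affects only which feasible points are optimal, not which points are feasible. *)

theory Defs
  imports Complex_Main "HOL-Library.Disjoint_Sets"
begin

text \<open>
  Complexes are abstract: a simplex is its finite nonempty vertex set, and the face
  relations \<open>\<sigma> \<le> \<tau>\<close> and \<open>\<sigma> < \<tau>\<close> are \<open>\<sigma> \<subseteq> \<tau>\<close> and \<open>\<sigma> \<subset> \<tau>\<close>. The predicate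
  \<open>simplicial_complex\<close> of HOL-Analysis is not used, since its complexes
  are geometric and closed under all faces, including the empty one.
\<close>

definition finite_simplicial_complex :: "'a set set \<Rightarrow> bool" where
  "finite_simplicial_complex K \<longleftrightarrow>
     finite K \<and>
     (\<forall>\<sigma>\<in>K. finite \<sigma> \<and> \<sigma> \<noteq> {}) \<and>
     (\<forall>\<tau>\<in>K. \<forall>\<sigma>. \<sigma> \<subseteq> \<tau> \<and> \<sigma> \<noteq> {} \<longrightarrow> \<sigma> \<in> K)"

definition simplex_dim :: "'a set \<Rightarrow> int" where
  "simplex_dim \<sigma> = int (card \<sigma>) - 1"

definition toplexes :: "'a set set \<Rightarrow> 'a set set" where
  "toplexes K = {\<tau> \<in> K. \<forall>\<sigma>\<in>K. \<tau> \<subseteq> \<sigma> \<longrightarrow> \<sigma> = \<tau>}"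

definition convex_subset :: "'a set set \<Rightarrow> 'a set set \<Rightarrow> bool" where
  "convex_subset K A \<longleftrightarrow>
     A \<subseteq> K \<and> (\<forall>x\<in>A. \<forall>z\<in>A. \<forall>y\<in>K. x \<subseteq> y \<and> y \<subseteq> z \<longrightarrow> y \<in> A)"

definition combinatorial_multivector_field :: "'a set set \<Rightarrow> 'a set set set \<Rightarrow> bool" where
  "combinatorial_multivector_field K \<V> \<longleftrightarrow>
     partition_on K \<V> \<and> (\<forall>V\<in>\<V>. convex_subset K V)"

datatype 'v min_problem =
  Min_Problem (objective: "'v \<Rightarrow> real") (feasible_points: "'v set")

definition var_pairs :: "'a set set \<Rightarrow> ('a set \<times> 'a set) set" where
  "var_pairs K = {(\<sigma>, \<tau>). \<sigma> \<in> K \<and> \<tau> \<in> toplexes K \<and> \<sigma> \<subset> \<tau>}"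

text \<open>
  Cost vectors and points are total functions on pairs of simplices; only their values on
  \<open>var_pairs K\<close> are meaningful, and the values elsewhere are left unconstrained.
\<close>

definition mvf_problem ::
  "'a set set \<Rightarrow> ('a set \<times> 'a set \<Rightarrow> real) \<Rightarrow> ('a set \<times> 'a set \<Rightarrow> real) min_problem" where
  "mvf_problem K c = Min_Problem
     (\<lambda>z. \<Sum>p\<in>var_pairs K. c p * z p)
     {z. (\<forall>p\<in>var_pairs K. z p \<in> {0, 1}) \<and>
         (\<forall>\<sigma>\<in>K - toplexes K. (\<Sum>\<tau> | \<tau> \<in> toplexes K \<and> \<sigma> \<subset> \<tau>. z (\<sigma>, \<tau>)) = 1) \<and>
         (\<forall>\<sigma>\<^sub>i\<in>K. \<forall>\<sigma>\<^sub>j\<in>K. \<forall>\<tau>\<in>toplexes K.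
            \<sigma>\<^sub>i \<subset> \<sigma>\<^sub>j \<and> \<sigma>\<^sub>j \<subset> \<tau> \<and> simplex_dim \<sigma>\<^sub>i + 1 = simplex_dim \<sigma>\<^sub>j \<longrightarrow>
            z (\<sigma>\<^sub>i, \<tau>) - z (\<sigma>\<^sub>j, \<tau>) \<le> 0)}"

definition multivector_of ::
  "'a set set \<Rightarrow> ('a set \<times> 'a set \<Rightarrow> real) \<Rightarrow> 'a set \<Rightarrow> 'a set set" where
  "multivector_of K z \<tau> = {\<sigma> \<in> K. \<sigma> \<subset> \<tau> \<and> z (\<sigma>, \<tau>) = 1} \<union> {\<tau>}"

end

theory Submission
  imports Defs
begin

text \<open>
  The equality constraints, with binary variables, say that each non-maximal simplex is
  assigned to exactly one toplex, which gives a partition. Going from a simplex to a larger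
  one by adding one vertex at a time, the inequality constraints show that \<open>z (-, \<tau>)\<close> is
  monotone on the proper faces of \<open>\<tau>\<close>. So every \<open>V\<^sub>\<tau>\<close> is an upper set among the faces of
  \<open>\<tau>\<close>, hence convex.
\<close>

lemma feasible_binary:
  assumes "z \<in> feasible_points (mvf_problem K c)"
    and "\<sigma> \<in> K" "\<tau> \<in> toplexes K" "\<sigma> \<subset> \<tau>"
  shows "z (\<sigma>, \<tau>) = 0 \<or> z (\<sigma>, \<tau>) = 1"
  using assms by (auto simp: mvf_problem_def var_pairs_def)

lemma feasible_sum:
  assumes "z \<in> feasible_points (mvf_problem K c)" and "\<sigma> \<in> K - toplexes K"
  shows "(\<Sum>\<tau> | \<tau> \<in> toplexes K \<and> \<sigma> \<subset> \<tau>. z (\<sigma>, \<tau>)) = 1"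
  using assms by (simp add: mvf_problem_def)

lemma feasible_facet_le:
  assumes "z \<in> feasible_points (mvf_problem K c)"
    and "\<rho> \<in> K" "\<sigma> \<in> K" "\<tau> \<in> toplexes K" "\<rho> \<subset> \<sigma>" "\<sigma> \<subset> \<tau>"
    and "simplex_dim \<rho> + 1 = simplex_dim \<sigma>"
  shows "z (\<rho>, \<tau>) \<le> z (\<sigma>, \<tau>)"
  using assms by (auto simp: mvf_problem_def)

lemma not_toplex_of_psubset:
  assumes "\<sigma> \<subset> \<tau>" "\<tau> \<in> toplexes K"
  shows "\<sigma> \<notin> toplexes K"
  using assms by (auto simp: toplexes_def)

text \<open>The inequality constraints compare only simplices whose dimensions differ by one, so the
  general comparison is chained through intermediate simplices. Each of these contains
  \<open>\<rho>\<close> and lies in \<open>\<sigma>\<close>, so it is a nonempty proper face of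
  \<open>\<tau>\<close> and belongs to \<open>K\<close>.\<close>

lemma feasible_mono:
  assumes K: "finite_simplicial_complex K"
    and z: "z \<in> feasible_points (mvf_problem K c)"
    and \<rho>: "\<rho> \<in> K" and \<tau>: "\<tau> \<in> toplexes K" and "\<rho> \<subseteq> \<sigma>" "\<sigma> \<subset> \<tau>"
  shows "z (\<rho>, \<tau>) \<le> z (\<sigma>, \<tau>)"
proof -
  have "\<tau> \<in> K" using \<tau> by (simp add: toplexes_def)
  then have "finite \<tau>" using K by (simp add: finite_simplicial_complex_def)
  then have fin: "finite (\<sigma> - \<rho>)" using \<open>\<sigma> \<subset> \<tau>\<close> by (meson finite_Diff finite_subset psubsetE)
  have "finite \<rho>" "\<rho> \<noteq> {}" using K \<rho> by (auto simp: finite_simplicial_complex_def)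
  have in_K: "\<rho> \<union> F \<in> K" if "F \<subseteq> \<sigma> - \<rho>" for F
  proof -
    have "\<rho> \<union> F \<subseteq> \<tau>" "\<rho> \<union> F \<noteq> {}"
      using \<open>\<rho> \<noteq> {}\<close> \<open>\<rho> \<subseteq> \<sigma>\<close> \<open>\<sigma> \<subset> \<tau>\<close> that by auto
    then show ?thesis
      using K \<open>\<tau> \<in> K\<close> unfolding finite_simplicial_complex_def by blast
  qed
  \<comment> \<open>Rewriting \<open>\<sigma>\<close> this way allows induction on the set of added
    vertices. The induction rule keeps \<open>F\<close> and \<open>v\<close> inside
    \<open>\<sigma> - \<rho>\<close>, so \<open>in_K\<close> applies, and \<open>v\<close> is new to
    \<open>\<rho> \<union> F\<close>, so the dimension rises by exactly one.\<close>
  have "z (\<rho>, \<tau>) \<le> z (\<rho> \<union> (\<sigma> - \<rho>), \<tau>)"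
    using fin order_refl
  proof (induction rule: finite_subset_induct')
    case empty
    show ?case by simp
  next
    case (insert v F)
    have "z (\<rho> \<union> F, \<tau>) \<le> z (\<rho> \<union> insert v F, \<tau>)"
    proof (rule feasible_facet_le[OF z])
      show "\<rho> \<union> F \<in> K" "\<rho> \<union> insert v F \<in> K"
        using insert.hyps by (intro in_K; simp)+
      show "\<rho> \<union> F \<subset> \<rho> \<union> insert v F" "\<rho> \<union> insert v F \<subset> \<tau>"
        using insert.hyps \<open>\<rho> \<subseteq> \<sigma>\<close> \<open>\<sigma> \<subset> \<tau>\<close> by blast+
      show "simplex_dim (\<rho> \<union> F) + 1 = simplex_dim (\<rho> \<union> insert v F)"
        using insert.hyps \<open>finite \<rho>\<close> by (auto simp: simplex_dim_def)
    qed (rule \<tau>)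
    with insert.IH show ?case by linarith
  qed
  moreover have "\<rho> \<union> (\<sigma> - \<rho>) = \<sigma>" using \<open>\<rho> \<subseteq> \<sigma>\<close> by blast
  ultimately show ?thesis by simp
qed

lemma convex_multivector_of:
  assumes K: "finite_simplicial_complex K"
    and z: "z \<in> feasible_points (mvf_problem K c)" and \<tau>: "\<tau> \<in> toplexes K"
  shows "convex_subset K (multivector_of K z \<tau>)"
  unfolding convex_subset_def
proof (intro conjI ballI impI)
  show "multivector_of K z \<tau> \<subseteq> K"
    using \<tau> by (auto simp: multivector_of_def toplexes_def)
next
  fix x y w
  assume x: "x \<in> multivector_of K z \<tau>" and w: "w \<in> multivector_of K z \<tau>"
    and y: "y \<in> K" and xyw: "x \<subseteq> y \<and> y \<subseteq> w"
  show "y \<in> multivector_of K z \<tau>"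
  proof (cases "y = \<tau>")
    case False
    have "y \<subset> \<tau>" using w xyw False by (auto simp: multivector_of_def)
    \<comment> \<open>Since \<open>x \<subseteq> y \<subset> \<tau>\<close>, the case
      \<open>x = \<tau>\<close> is excluded.\<close>
    then have "x \<in> K" "z (x, \<tau>) = 1" using x xyw by (auto simp: multivector_of_def)
    then have "1 \<le> z (y, \<tau>)"
      using feasible_mono[OF K z \<open>x \<in> K\<close> \<tau> _ \<open>y \<subset> \<tau>\<close>] xyw by simp
    then have "z (y, \<tau>) = 1" using feasible_binary[OF z y \<tau> \<open>y \<subset> \<tau>\<close>] by auto
    then show ?thesis using y \<open>y \<subset> \<tau>\<close> by (simp add: multivector_of_def)
  qed (simp add: multivector_of_def)
qed

text \<open>A toplex lies in its own multivector. For any other simplex the sum of its variables is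
  1, so some term is nonzero, and a nonzero binary variable equals 1.\<close>

lemma multivector_of_cover:
  assumes z: "z \<in> feasible_points (mvf_problem K c)" and \<sigma>: "\<sigma> \<in> K"
  obtains \<tau> where "\<tau> \<in> toplexes K" "\<sigma> \<in> multivector_of K z \<tau>"
proof (cases "\<sigma> \<in> toplexes K")
  case True
  then show ?thesis using that by (auto simp: multivector_of_def)
next
  case False
  then have "(\<Sum>\<tau> | \<tau> \<in> toplexes K \<and> \<sigma> \<subset> \<tau>. z (\<sigma>, \<tau>)) \<noteq> 0"
    using feasible_sum[OF z] \<sigma> by simp
  then obtain \<tau> where \<tau>: "\<tau> \<in> toplexes K" "\<sigma> \<subset> \<tau>" "z (\<sigma>, \<tau>) \<noteq> 0"
    by (elim sum.not_neutral_contains_not_neutral) blast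
  then have "z (\<sigma>, \<tau>) = 1" using feasible_binary[OF z \<sigma>] by blast
  then show ?thesis using that \<tau> \<sigma> by (simp add: multivector_of_def)
qed

text \<open>A toplex is not a proper face of another toplex, so it lies only in its own multivector.
  For any other simplex, two distinct toplexes would each contribute 1 to a sum of nonnegative terms
  that equals 1.\<close>

lemma multivector_of_unique:
  assumes K: "finite_simplicial_complex K"
    and z: "z \<in> feasible_points (mvf_problem K c)"
    and \<tau>: "\<tau> \<in> toplexes K" "\<sigma> \<in> multivector_of K z \<tau>"
    and \<tau>': "\<tau>' \<in> toplexes K" "\<sigma> \<in> multivector_of K z \<tau>'"
  shows "\<tau> = \<tau>'"
proof (cases "\<sigma> \<in> toplexes K")
  case True
  then have "\<not> \<sigma> \<subset> \<tau>" "\<not> \<sigma> \<subset> \<tau>'"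
    using \<tau> \<tau>' not_toplex_of_psubset by metis+
  then show ?thesis
    using \<tau> \<tau>' by (simp add: multivector_of_def)
next
  case False
  then have \<sigma>: "\<sigma> \<in> K" "\<sigma> \<subset> \<tau>" "\<sigma> \<subset> \<tau>'" "z (\<sigma>, \<tau>) = 1" "z (\<sigma>, \<tau>') = 1"
    using \<tau> \<tau>' by (auto simp: multivector_of_def)
  let ?S = "{\<tau>. \<tau> \<in> toplexes K \<and> \<sigma> \<subset> \<tau>}"
  have "finite ?S"
    using K by (simp add: finite_simplicial_complex_def toplexes_def)
  show ?thesis
  proof (rule ccontr)
    assume "\<tau> \<noteq> \<tau>'"
    then have "2 = (\<Sum>\<upsilon>\<in>{\<tau>, \<tau>'}. z (\<sigma>, \<upsilon>))" using \<sigma> by simp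
    also have "\<dots> \<le> (\<Sum>\<upsilon>\<in>?S. z (\<sigma>, \<upsilon>))"
    proof (rule sum_mono2[OF \<open>finite ?S\<close>])
      show "{\<tau>, \<tau>'} \<subseteq> ?S" using \<tau> \<tau>' \<sigma> by simp
      show "0 \<le> z (\<sigma>, \<upsilon>)" if "\<upsilon> \<in> ?S - {\<tau>, \<tau>'}" for \<upsilon>
        using feasible_binary[OF z \<sigma>(1), of \<upsilon>] that by auto
    qed
    also have "\<dots> = 1" using feasible_sum[OF z] \<sigma>(1) False by simp
    finally show False by simp
  qed
qed

theorem theorem3p6:
  fixes K :: "'a set set"
    and c z :: "'a set \<times> 'a set \<Rightarrow> real"
  assumes "finite_simplicial_complex K"
    and "z \<in> feasible_points (mvf_problem K c)"
  shows "combinatorial_multivector_field K {multivector_of K z \<tau> | \<tau>. \<tau> \<in> toplexes K}"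
  unfolding combinatorial_multivector_field_def
proof (intro conjI ballI partition_onI)
  show "convex_subset K V" if "V \<in> {multivector_of K z \<tau> | \<tau>. \<tau> \<in> toplexes K}" for V
    using that convex_multivector_of[OF assms] by blast
  then have "\<Union>{multivector_of K z \<tau> | \<tau>. \<tau> \<in> toplexes K} \<subseteq> K"
    by (auto simp: convex_subset_def)
  moreover have "\<sigma> \<in> \<Union>{multivector_of K z \<tau> | \<tau>. \<tau> \<in> toplexes K}" if "\<sigma> \<in> K" for \<sigma>
    using multivector_of_cover[OF assms(2) that] by blast
  ultimately show "\<Union>{multivector_of K z \<tau> | \<tau>. \<tau> \<in> toplexes K} = K"
    by (meson subset_antisym subsetI)
  \<comment> \<open>Disjointness is required for distinct sets rather than distinct indices: a
    common simplex forces equal toplexes, hence \<open>V = W\<close>.\<close>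
  show "disjnt V W"
    if "V \<in> {multivector_of K z \<tau> | \<tau>. \<tau> \<in> toplexes K}"
      and "W \<in> {multivector_of K z \<tau> | \<tau>. \<tau> \<in> toplexes K}" and "V \<noteq> W" for V W
    using that by (auto simp: disjnt_iff dest: multivector_of_unique[OF assms])
  \<comment> \<open>Every multivector contains the toplex that indexes it.\<close>
  show "{} \<notin> {multivector_of K z \<tau> | \<tau>. \<tau> \<in> toplexes K}"
    by (auto simp: multivector_of_def)
qed

end
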